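(* Let $m\ge 0$, $n\ge 1$ and let $T$ be an $n$-simplex. Let $v\in P_T^{(m,n)}$ be such that $d(v)=0$ for all $d\in D_T^{(m,n)}$. Then for every multi-index $\beta$ with $|\beta|\le m$, $$d_T(\partial^{\beta}v)=0\qquad\forall\, d_T\in D_T^{(m-|\beta|,n)}.$$
   Context: Let $n\ge 1$ be an integer and $T$ a (nondegenerate) $n$-simplex in $\mathbb{R}^n$; $\mathcal{P}_k(T)$ denotes the polynomials on $T$ of degree at most $k$. For $0\le k\le n$, $\mathcal{F}_{T,k}$ is the set of all $(n-k)$-dimensional sub-simplices of $T$. For $F\in\mathcal{F}_{T,k}$ with $1\le k\le n$, $|F|$ is its $(n-k)$-dimensional measure ($|F|=1$ and $\int_F$ is point evaluation when $F$ is a vertex, $k=n$), and $\nu_{F,1},\dots,\nu_{F,k}$ are fixed linearly independent unit vectors orthogonal to the tangent space of $F$. For $1\le k\le n$, $A_k$ is the set of $n$-dimensional multi-indices $\alpha=(\alpha_1,\dots,\alpha_n)$ with $\sum_{i=k+1}^n\alpha_i=0$. Set $$d_{T,F,\alpha}(v):=\frac1{|F|}\int_F\frac{\partial^{|\alpha|}v}{\partial\nu_{F,1}^{\alpha_1}\cdots\partial\nu_{F,k}^{\alpha_k}},\qquad d_{T,0}(v):=\frac1{|T|}\int_T v.$$ For any integer $m\ge 0$ let $L=\lfloor m/(n+1)\rfloor$, $P_T^{(m,n)}:=\mathcal{P}_m(T)$, and for $0\le\ell\le L$ define $$\tilde D_{T,\ell}^{(m,n)}:=\{d_{T,F,\alpha}\;:\;F\in\mathcal{F}_{T,k},\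 1\le k\le\min\{n,m-(n+1)(L-\ell)\},\ \alpha\in A_k,\ |\alpha|=m-k-(n+1)(L-\ell)\};$$ define also $\tilde D_{T,-1}^{(m,n)}:=\{d_{T,0}\}$ if $m\equiv 0\pmod{n+1}$ and $\tilde D_{T,-1}^{(m,n)}:=\varnothing$ otherwise. The set of degrees of freedom is $D_T^{(m,n)}:=\bigcup_{\ell=-1}^{L}\tilde D_{T,\ell}^{(m,n)}$. The set $D_T^{(m-|\beta|,n)}$ is given by the same definition with $m$ replaced by $m-|\beta|$ (and $L$ by $\lfloor (m-|\beta|)/(n+1)\rfloor$). *)

theory Defs
  imports "HOL-Analysis.Analysis"
begin

text \<open>
  Polynomials of degree at most \<open>m\<close> on an \<open>n\<close>-simplex are represented by the polynomial functions on
  all of \<open>\<real>\<^sup>n\<close>: the simplex has nonempty interior, so restriction to it loses nothing. The index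
  set of the sum is finite.
\<close>

definition polys :: "nat \<Rightarrow> (real^'n \<Rightarrow> real) set" where
  "polys m = {v. \<exists>c :: ('n \<Rightarrow> nat) \<Rightarrow> real.
     v = (\<lambda>x. \<Sum>\<alpha> | (\<Sum>i\<in>UNIV. \<alpha> i) \<le> m. c \<alpha> * (\<Prod>i\<in>UNIV. x $ i ^ \<alpha> i))}"

definition dir_deriv :: "real^'n \<Rightarrow> (real^'n \<Rightarrow> real) \<Rightarrow> real^'n \<Rightarrow> real" where
  "dir_deriv u f = (\<lambda>x. frechet_derivative f (at x) u)"

text \<open>
  The partial derivative with respect to a multi-index indexed by the coordinates. The index type
  carries no order, so an enumeration of the coordinates is chosen; on smooth functions the result
  does not depend on it.
\<close>

definition partial_deriv :: "('n \<Rightarrow> nat) \<Rightarrow> (real^'n \<Rightarrow> real) \<Rightarrow> real^'n \<Rightarrow> real" where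
  "partial_deriv \<beta> v =
     foldr (\<lambda>i. dir_deriv (axis i 1) ^^ \<beta> i) (SOME is. distinct is \<and> set is = (UNIV :: 'n set)) v"

text \<open>\<open>\<partial>\<^sup>|\<^sup>\<alpha>\<^sup>|v / \<partial>\<nu>\<^sub>1\<^bsup>\<alpha>\<^sub>1\<^esup> \<dots> \<partial>\<nu>\<^sub>k\<^bsup>\<alpha>\<^sub>k\<^esup>\<close>\<close>

definition mixed_deriv ::
  "nat \<Rightarrow> (nat \<Rightarrow> real^'n) \<Rightarrow> (nat \<Rightarrow> nat) \<Rightarrow> (real^'n \<Rightarrow> real) \<Rightarrow> real^'n \<Rightarrow> real" where
  "mixed_deriv k \<nu> \<alpha> v = foldr (\<lambda>i. dir_deriv (\<nu> i) ^^ \<alpha> i) [1..<Suc k] v"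

text \<open>\<open>n\<close>-dimensional multi-indices \<open>(\<alpha>\<^sub>1, \<dots>, \<alpha>\<^sub>n)\<close> are functions on \<open>nat\<close> vanishing outside \<open>{1..n}\<close>.\<close>

definition multi_indices :: "nat \<Rightarrow> (nat \<Rightarrow> nat) set" where
  "multi_indices n = {\<alpha>. \<forall>i. i \<notin> {1..n} \<longrightarrow> \<alpha> i = 0}"

definition A_set :: "nat \<Rightarrow> nat \<Rightarrow> (nat \<Rightarrow> nat) set" where
  "A_set n k = {\<alpha> \<in> multi_indices n. (\<Sum>i = k + 1..n. \<alpha> i) = 0}"

definition sub_simplices :: "(real^'n) set \<Rightarrow> nat \<Rightarrow> (real^'n) set set" where
  "sub_simplices T k = {F. F face_of T \<and> (int CARD('n) - int k) simplex F}"

definition tangent_space :: "'a::euclidean_space set \<Rightarrow> 'a set" where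
  "tangent_space F = span {x - y | x y. x \<in> F \<and> y \<in> F}"

text \<open>
  The Lebesgue measure of dimension \<open>dim (tangent_space F)\<close> on the affine hull of a nonempty flat set
  \<open>F\<close>, seen as a Borel measure on the ambient space: the image of the Lebesgue measure on the
  coordinates with respect to an orthonormal basis \<open>B\<close> of the tangent space, with origin \<open>p \<in> F\<close>
  (for \<open>B = Basis\<close> and \<open>p = 0\<close> this is the definition of \<^const>\<open>lborel\<close>). Since Lebesgue measure is
  invariant under isometries, the choice of \<open>p\<close> and \<open>B\<close> is immaterial. If \<open>F\<close> is a single point
  then \<open>B\<close> is empty, and the measure is the unit point mass there.
\<close>

definition orthonormal_basis_of :: "'a::euclidean_space set \<Rightarrow> 'a set \<Rightarrow> bool" where
  "orthonormal_basis_of B V \<longleftrightarrow>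
     pairwise orthogonal B \<and> (\<forall>b\<in>B. norm b = 1) \<and> span B = V"

definition flat_measure :: "'a::euclidean_space set \<Rightarrow> 'a measure" where
  "flat_measure F =
     (let p = (SOME p. p \<in> F); B = (SOME B. orthonormal_basis_of B (tangent_space F))
      in distr (\<Pi>\<^sub>M b\<in>B. (lborel :: real measure)) borel (\<lambda>t. p + (\<Sum>b\<in>B. t b *\<^sub>R b)))"

text \<open>
  \<open>\<nu> F 1, \<dots>, \<nu> F k\<close> are linearly independent unit normals of every sub-simplex \<open>F\<close> of codimension \<open>k\<close>.
\<close>

definition normal_frames ::
  "(real^'n) set \<Rightarrow> ((real^'n) set \<Rightarrow> nat \<Rightarrow> real^'n) \<Rightarrow> bool" where
  "normal_frames T \<nu> \<longleftrightarrow> (\<forall>k\<in>{1..CARD('n)}. \<forall>F\<in>sub_simplices T k.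
     (\<forall>i\<in>{1..k}. norm (\<nu> F i) = 1 \<and> (\<forall>t\<in>tangent_space F. orthogonal (\<nu> F i) t)) \<and>
     inj_on (\<nu> F) {1..k} \<and> independent (\<nu> F ` {1..k}))"

definition dof_face ::
  "((real^'n) set \<Rightarrow> nat \<Rightarrow> real^'n) \<Rightarrow> nat \<Rightarrow> (real^'n) set \<Rightarrow> (nat \<Rightarrow> nat) \<Rightarrow>
   (real^'n \<Rightarrow> real) \<Rightarrow> real" where
  "dof_face \<nu> k F \<alpha> v =
     (LINT x:F|flat_measure F. mixed_deriv k (\<nu> F) \<alpha> v x) / measure (flat_measure F) F"

definition dof_mean :: "(real^'n) set \<Rightarrow> (real^'n \<Rightarrow> real) \<Rightarrow> real" where
  "dof_mean T v = (LINT x:T|lborel. v x) / measure lborel T"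

text \<open>
  The subtractions on \<open>nat\<close> below are exact: \<open>(n + 1) * (L - l) \<le> m\<close>, and \<open>k \<le> m - (n + 1) * (L - l)\<close>.
  The level \<open>-1\<close> of the degrees of freedom is \<open>dofs_mean\<close>.
\<close>

definition dofs_level ::
  "(real^'n) set \<Rightarrow> ((real^'n) set \<Rightarrow> nat \<Rightarrow> real^'n) \<Rightarrow> nat \<Rightarrow> nat \<Rightarrow>
   ((real^'n \<Rightarrow> real) \<Rightarrow> real) set" where
  "dofs_level T \<nu> m l = (let n = CARD('n); L = m div (n + 1) in
     {dof_face \<nu> k F \<alpha> | F k \<alpha>.
        F \<in> sub_simplices T k \<and> 1 \<le> k \<and> k \<le> min n (m - (n + 1) * (L - l)) \<and>
        \<alpha> \<in> A_set n k \<and> (\<Sum>i = 1..n. \<alpha> i) = m - k - (n + 1) * (L - l)})"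

definition dofs_mean :: "(real^'n) set \<Rightarrow> nat \<Rightarrow> ((real^'n \<Rightarrow> real) \<Rightarrow> real) set" where
  "dofs_mean T m = (if m mod (CARD('n) + 1) = 0 then {dof_mean T} else {})"

definition dofs ::
  "(real^'n) set \<Rightarrow> ((real^'n) set \<Rightarrow> nat \<Rightarrow> real^'n) \<Rightarrow> nat \<Rightarrow>
   ((real^'n \<Rightarrow> real) \<Rightarrow> real) set" where
  "dofs T \<nu> m = dofs_mean T m \<union> (\<Union>l\<in>{0..m div (CARD('n) + 1)}. dofs_level T \<nu> m l)"

end

theory Submission
  imports Defs
begin

text \<open>
  Let \<open>n = CARD('n)\<close>. By induction on \<open>r \<le> m\<close>, every derivative of \<open>v\<close> of order \<open>r\<close>, in arbitrary
  directions, has integral zero over every sub-simplex \<open>F\<close> of codimension \<open>k = (m - r) mod (n + 1)\<close>;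
  the degrees of freedom of \<open>\<partial>\<^sup>\<beta> v\<close> are quotients of such integrals. By multilinearity each direction
  may be taken to be an edge of \<open>F\<close> or one of the chosen normals. If all directions are normals, or
  if \<open>r = 0\<close>, the integral is a degree of freedom of \<open>v\<close>. Otherwise the derivative along an edge
  \<open>b - a\<close> is integrated out by Fubini: the result is the difference of the integrals of a
  derivative of order \<open>r - 1\<close> over the facets of \<open>F\<close> opposite to \<open>a\<close> and to \<open>b\<close>, which have
  codimension \<open>k + 1 = (m - (r - 1)) mod (n + 1)\<close>.
\<close>

section \<open>Lebesgue measure on flats\<close>

text \<open>Puts orthonormal bases and the edge vectors of a simplex under one notion. There is no
  Jacobian factor, so for an independent family \<open>e\<close> this is Lebesgue measure on the
  flat through \<open>p\<close> only up to a positive constant.\<close>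

definition frame_measure :: "'i set \<Rightarrow> ('i \<Rightarrow> 'a::euclidean_space) \<Rightarrow> 'a \<Rightarrow> 'a measure" where
  "frame_measure I e p = distr (\<Pi>\<^sub>M i\<in>I. lborel) borel (\<lambda>t. p + (\<Sum>i\<in>I. t i *\<^sub>R e i))"

lemma frame_map_measurable [measurable]:
  fixes e :: "'i \<Rightarrow> 'a::euclidean_space"
  shows "(\<lambda>t. p + (\<Sum>i\<in>I. t i *\<^sub>R e i)) \<in> borel_measurable (\<Pi>\<^sub>M i\<in>I. (lborel :: real measure))"
  by (intro borel_measurable_add borel_measurable_const borel_measurable_sum borel_measurable_scaleR)
     (auto intro: measurable_compose[OF measurable_component_singleton])

lemma space_frame_measure [simp]: "space (frame_measure I e p) = UNIV"
  and sets_frame_measure [simp, measurable_cong]: "sets (frame_measure I e p) = sets borel"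
  by (auto simp: frame_measure_def)

lemma nn_integral_frame_measure:
  assumes "f \<in> borel_measurable borel"
  shows "(\<integral>\<^sup>+x. f x \<partial>frame_measure I e p) =
    (\<integral>\<^sup>+t. f (p + (\<Sum>i\<in>I. t i *\<^sub>R e i)) \<partial>(\<Pi>\<^sub>M i\<in>I. lborel))"
  unfolding frame_measure_def using assms by (simp add: nn_integral_distr)

lemma emeasure_frame_measure_shift:
  assumes "A \<in> sets borel"
  shows "emeasure (frame_measure I e p) A = emeasure (frame_measure I e 0) ((\<lambda>x. p + x) -` A)"
proof -
  have "(\<lambda>x. p + x) -` A \<in> sets borel"
    using measurable_sets_borel[of "\<lambda>x. p + x" borel A] assms by auto
  then show ?thesis
    using assms frame_map_measurable[of 0 e I] frame_map_measurable[of p e I]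
    by (simp add: frame_measure_def emeasure_distr vimage_def)
qed

section \<open>Translation invariance\<close>

lemma sigma_finite_PiM_lborel:
  assumes "finite I"
  shows "sigma_finite_measure (\<Pi>\<^sub>M i\<in>I. (lborel :: real measure))"
proof -
  interpret product_sigma_finite "\<lambda>_::'a. lborel :: real measure" by standard
  show ?thesis using assms by (rule sigma_finite)
qed

text \<open>A product measure is determined by its values on boxes, and a translated box keeps its
  measure because every factor \<open>lborel\<close> is translation invariant.\<close>

lemma PiM_lborel_translate:
  assumes "finite I"
  shows "distr (\<Pi>\<^sub>M i\<in>I. lborel) (\<Pi>\<^sub>M i\<in>I. lborel) (\<lambda>t. \<lambda>i\<in>I. s i + t i) = (\<Pi>\<^sub>M i\<in>I. (lborel :: real measure))"
proof -
  interpret product_sigma_finite "\<lambda>_::'a. lborel :: real measure" by standard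
  have meas: "(\<lambda>t. \<lambda>i\<in>I. s i + t i) \<in>
      (\<Pi>\<^sub>M i\<in>I. (lborel :: real measure)) \<rightarrow>\<^sub>M (\<Pi>\<^sub>M i\<in>I. lborel)"
    by (intro measurable_restrict borel_measurable_add borel_measurable_const)
       (auto intro: measurable_compose[OF measurable_component_singleton])
  show ?thesis
  proof (rule PiM_eqI[OF assms])
    show "sets (distr (\<Pi>\<^sub>M i\<in>I. lborel) (\<Pi>\<^sub>M i\<in>I. lborel) (\<lambda>t. \<lambda>i\<in>I. s i + t i)) =
      sets (\<Pi>\<^sub>M i\<in>I. (lborel :: real measure))" by simp
    fix A :: "'a \<Rightarrow> real set"
    assume A: "\<And>i. i \<in> I \<Longrightarrow> A i \<in> sets lborel"
    have A': "(\<lambda>x. s i + x) -` A i \<in> sets borel" if "i \<in> I" for i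
      using measurable_sets_borel[of "\<lambda>x. s i + x" borel "A i"] A[OF that] by auto
    have "emeasure (distr (\<Pi>\<^sub>M i\<in>I. lborel) (\<Pi>\<^sub>M i\<in>I. lborel) (\<lambda>t. \<lambda>i\<in>I. s i + t i)) (Pi\<^sub>E I A) =
      emeasure (\<Pi>\<^sub>M i\<in>I. lborel) ((\<lambda>t. \<lambda>i\<in>I. s i + t i) -` Pi\<^sub>E I A \<inter> space (\<Pi>\<^sub>M i\<in>I. lborel))"
      using A by (intro emeasure_distr meas sets_PiM_I_finite assms) auto
    also have "(\<lambda>t. \<lambda>i\<in>I. s i + t i) -` Pi\<^sub>E I A \<inter> space (\<Pi>\<^sub>M i\<in>I. (lborel :: real measure)) =
       Pi\<^sub>E I (\<lambda>i. (\<lambda>x. s i + x) -` A i)"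
      by (auto simp: space_PiM PiE_def Pi_def extensional_def)
    also have "emeasure (\<Pi>\<^sub>M i\<in>I. lborel) \<dots> = (\<Prod>i\<in>I. emeasure lborel ((\<lambda>x. s i + x) -` A i))"
      using A' by (intro emeasure_PiM assms) auto
    also have "\<dots> = (\<Prod>i\<in>I. emeasure lborel (A i))"
    proof (rule prod.cong)
      fix i assume i: "i \<in> I"
      have "emeasure lborel (A i) = emeasure (distr lborel borel ((+) (s i))) (A i)"
        by (simp add: lborel_distr_plus)
      also have "\<dots> = emeasure lborel ((\<lambda>x. s i + x) -` A i)"
        using A[OF i] by (subst emeasure_distr) auto
      finally show "emeasure lborel ((\<lambda>x. s i + x) -` A i) = emeasure lborel (A i)" by simp
    qed simp
    finally show "emeasure (distr (\<Pi>\<^sub>M i\<in>I. lborel) (\<Pi>\<^sub>M i\<in>I. lborel) (\<lambda>t. \<lambda>i\<in>I. s i + t i)) (Pi\<^sub>E I A) =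
       (\<Prod>i\<in>I. emeasure lborel (A i))" .
  qed
qed

lemma span_image_coordinates:
  assumes "finite I" and "x \<in> span (e ` I)"
  obtains s where "x = (\<Sum>i\<in>I. s i *\<^sub>R e i)"
proof -
  have "\<exists>s. x = (\<Sum>i\<in>I. s i *\<^sub>R e i)"
    using assms(2)
  proof (induction rule: span_induct_alt)
    case base
    show ?case by (rule exI[of _ "\<lambda>_. 0"]) simp
  next
    case (step c y z)
    then obtain i s where i: "i \<in> I" "y = e i" and s: "z = (\<Sum>i\<in>I. s i *\<^sub>R e i)" by auto
    have "c *\<^sub>R y = (\<Sum>j\<in>I. (if j = i then c else 0) *\<^sub>R e j)"
      using assms(1) i by (simp add: if_distrib[of "\<lambda>c. c *\<^sub>R _"] cong: if_cong)
    then have "c *\<^sub>R y + z = (\<Sum>j\<in>I. ((if j = i then c else 0) + s j) *\<^sub>R e j)"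
      by (simp add: s scaleR_left_distrib sum.distrib)
    then show ?case by (rule exI[of _ "\<lambda>j. (if j = i then c else 0) + s j"])
  qed
  with that show ?thesis by blast
qed

text \<open>If \<open>s\<close> are coordinates of \<open>p - q\<close>, moving the base point from
  \<open>q\<close> to \<open>p\<close> amounts to translating the parameters by \<open>s\<close>,
  which preserves the product measure.\<close>

lemma frame_measure_translate:
  assumes I: "finite I" and pq: "p - q \<in> span (e ` I)"
  shows "frame_measure I e p = frame_measure I e q"
proof -
  obtain s where s: "p - q = (\<Sum>i\<in>I. s i *\<^sub>R e i)"
    using span_image_coordinates[OF I pq] .
  have meas: "(\<lambda>t. \<lambda>i\<in>I. s i + t i) \<in>
      (\<Pi>\<^sub>M i\<in>I. (lborel :: real measure)) \<rightarrow>\<^sub>M (\<Pi>\<^sub>M i\<in>I. lborel)"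
    by (intro measurable_restrict borel_measurable_add borel_measurable_const)
       (auto intro: measurable_compose[OF measurable_component_singleton])
  have "frame_measure I e q =
    distr (distr (\<Pi>\<^sub>M i\<in>I. lborel) (\<Pi>\<^sub>M i\<in>I. lborel) (\<lambda>t. \<lambda>i\<in>I. s i + t i)) borel
      (\<lambda>t. q + (\<Sum>i\<in>I. t i *\<^sub>R e i))"
    unfolding frame_measure_def PiM_lborel_translate[OF I] ..
  also have "\<dots> = distr (\<Pi>\<^sub>M i\<in>I. lborel) borel
      ((\<lambda>t. q + (\<Sum>i\<in>I. t i *\<^sub>R e i)) \<circ> (\<lambda>t. \<lambda>i\<in>I. s i + t i))"
    by (intro distr_distr frame_map_measurable meas)
  also have "(\<lambda>t. q + (\<Sum>i\<in>I. t i *\<^sub>R e i)) \<circ> (\<lambda>t. \<lambda>i\<in>I. s i + t i) =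
      (\<lambda>t. p + (\<Sum>i\<in>I. t i *\<^sub>R e i))"
  proof
    fix t
    have "(\<Sum>i\<in>I. (\<lambda>i\<in>I. s i + t i) i *\<^sub>R e i) = (p - q) + (\<Sum>i\<in>I. t i *\<^sub>R e i)"
      unfolding s by (simp add: scaleR_left_distrib sum.distrib)
    then show "((\<lambda>t. q + (\<Sum>i\<in>I. t i *\<^sub>R e i)) \<circ> (\<lambda>t. \<lambda>i\<in>I. s i + t i)) t =
        p + (\<Sum>i\<in>I. t i *\<^sub>R e i)"
      by simp
  qed
  finally show ?thesis unfolding frame_measure_def by simp
qed

text \<open>
  The two-line uniqueness proof for Haar measure: substitute \<open>y \<rightarrow> y - x\<close>, then \<open>x \<rightarrow> x + y\<close>, in
  \<open>\<integral>\<integral> f x * g y\<close>. It replaces the change of variables formula, which the library has only on whole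
  Euclidean spaces, not on products over index sets.
\<close>

lemma frame_measure_exchange:
  fixes e :: "'i \<Rightarrow> 'a::euclidean_space" and e' :: "'j \<Rightarrow> 'a"
  assumes I: "finite I" and J: "finite J" and span: "span (e ` I) = span (e' ` J)"
    and f [measurable]: "f \<in> borel_measurable borel" and g [measurable]: "g \<in> borel_measurable borel"
  shows "(\<integral>\<^sup>+x. f x \<partial>frame_measure I e 0) * (\<integral>\<^sup>+y. g y \<partial>frame_measure J e' 0) =
    (\<integral>\<^sup>+x. g (- x) \<partial>frame_measure I e 0) * (\<integral>\<^sup>+y. f y \<partial>frame_measure J e' 0)"
proof -
  let ?P = "\<Pi>\<^sub>M i\<in>I. (lborel :: real measure)" and ?Q = "\<Pi>\<^sub>M i\<in>J. (lborel :: real measure)"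
  let ?\<phi> = "\<lambda>t. \<Sum>i\<in>I. t i *\<^sub>R e i" and ?\<psi> = "\<lambda>t. \<Sum>j\<in>J. t j *\<^sub>R e' j"
  have [measurable]: "?\<phi> \<in> borel_measurable ?P" "?\<psi> \<in> borel_measurable ?Q"
    using frame_map_measurable[of 0 e I] frame_map_measurable[of 0 e' J] by auto
  interpret P: sigma_finite_measure ?P by (rule sigma_finite_PiM_lborel[OF I])
  interpret Q: sigma_finite_measure ?Q by (rule sigma_finite_PiM_lborel[OF J])
  interpret PQ: pair_sigma_finite ?P ?Q ..
  have P0: "(\<integral>\<^sup>+t. h (?\<phi> t) \<partial>?P) = (\<integral>\<^sup>+x. h x \<partial>frame_measure I e 0)"
    if "h \<in> borel_measurable borel" for h using nn_integral_frame_measure[OF that, of I e 0] by simp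
  have Q0: "(\<integral>\<^sup>+t. h (?\<psi> t) \<partial>?Q) = (\<integral>\<^sup>+x. h x \<partial>frame_measure J e' 0)"
    if "h \<in> borel_measurable borel" for h using nn_integral_frame_measure[OF that, of J e' 0] by simp
  have Pt: "(\<integral>\<^sup>+t. h (x + ?\<phi> t) \<partial>?P) = (\<integral>\<^sup>+t. h (?\<phi> t) \<partial>?P)"
    if "h \<in> borel_measurable borel" "x \<in> span (e ` I)" for h x
    using nn_integral_frame_measure[OF that(1), of I e x] frame_measure_translate[OF I, of x 0 e] that
    by (simp add: P0)
  have Qt: "(\<integral>\<^sup>+t. h (x + ?\<psi> t) \<partial>?Q) = (\<integral>\<^sup>+t. h (?\<psi> t) \<partial>?Q)"
    if "h \<in> borel_measurable borel" "x \<in> span (e' ` J)" for h x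
    using nn_integral_frame_measure[OF that(1), of J e' x] frame_measure_translate[OF J, of x 0 e'] that
    by (simp add: Q0)
  have \<phi>: "?\<phi> t \<in> span (e ` I)" for t by (intro span_sum span_scale span_base) auto
  have \<psi>: "?\<psi> t \<in> span (e' ` J)" for t by (intro span_sum span_scale span_base) auto
  have "(\<integral>\<^sup>+x. f x \<partial>frame_measure I e 0) * (\<integral>\<^sup>+y. g y \<partial>frame_measure J e' 0) =
    (\<integral>\<^sup>+t. f (?\<phi> t) * (\<integral>\<^sup>+s. g (?\<psi> s) \<partial>?Q) \<partial>?P)"
    by (simp add: nn_integral_multc flip: P0 Q0)
  also have "\<dots> = (\<integral>\<^sup>+t. (\<integral>\<^sup>+s. f (?\<phi> t) * g (- ?\<phi> t + ?\<psi> s) \<partial>?Q) \<partial>?P)"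
  proof (rule nn_integral_cong)
    fix t
    have "(\<integral>\<^sup>+s. g (?\<psi> s) \<partial>?Q) = (\<integral>\<^sup>+s. g (- ?\<phi> t + ?\<psi> s) \<partial>?Q)"
      using Qt[of g "- ?\<phi> t"] \<phi>[of t] span by (simp add: span_neg)
    then show "f (?\<phi> t) * (\<integral>\<^sup>+s. g (?\<psi> s) \<partial>?Q) = (\<integral>\<^sup>+s. f (?\<phi> t) * g (- ?\<phi> t + ?\<psi> s) \<partial>?Q)"
      by (simp add: nn_integral_cmult)
  qed
  also have "\<dots> = (\<integral>\<^sup>+s. (\<integral>\<^sup>+t. f (?\<phi> t) * g (- ?\<phi> t + ?\<psi> s) \<partial>?P) \<partial>?Q)"
    by (rule PQ.Fubini'[of "\<lambda>t s. f (?\<phi> t) * g (- ?\<phi> t + ?\<psi> s)", symmetric]) measurable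
  also have "\<dots> = (\<integral>\<^sup>+s. (\<integral>\<^sup>+t. f (?\<psi> s + ?\<phi> t) * g (- ?\<phi> t) \<partial>?P) \<partial>?Q)"
  proof (rule nn_integral_cong)
    fix s
    have "(\<integral>\<^sup>+t. f (?\<phi> t) * g (- ?\<phi> t + ?\<psi> s) \<partial>?P) =
        (\<integral>\<^sup>+t. f (?\<psi> s + ?\<phi> t) * g (- (?\<psi> s + ?\<phi> t) + ?\<psi> s) \<partial>?P)"
      using Pt[of "\<lambda>x. f x * g (- x + ?\<psi> s)" "?\<psi> s"] \<psi>[of s] span by simp
    then show "(\<integral>\<^sup>+t. f (?\<phi> t) * g (- ?\<phi> t + ?\<psi> s) \<partial>?P) =
        (\<integral>\<^sup>+t. f (?\<psi> s + ?\<phi> t) * g (- ?\<phi> t) \<partial>?P)"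
      by simp
  qed
  also have "\<dots> = (\<integral>\<^sup>+t. (\<integral>\<^sup>+s. f (?\<psi> s + ?\<phi> t) * g (- ?\<phi> t) \<partial>?Q) \<partial>?P)"
    by (rule PQ.Fubini'[of "\<lambda>t s. f (?\<psi> s + ?\<phi> t) * g (- ?\<phi> t)"]) measurable
  also have "\<dots> = (\<integral>\<^sup>+t. (\<integral>\<^sup>+s. f (?\<psi> s) \<partial>?Q) * g (- ?\<phi> t) \<partial>?P)"
  proof (rule nn_integral_cong)
    fix t
    have "(\<integral>\<^sup>+s. f (?\<psi> s) \<partial>?Q) = (\<integral>\<^sup>+s. f (?\<phi> t + ?\<psi> s) \<partial>?Q)"
      using Qt[of f "?\<phi> t"] \<phi>[of t] span by simp
    then show "(\<integral>\<^sup>+s. f (?\<psi> s + ?\<phi> t) * g (- ?\<phi> t) \<partial>?Q) = (\<integral>\<^sup>+s. f (?\<psi> s) \<partial>?Q) * g (- ?\<phi> t)"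
      by (simp add: nn_integral_multc add.commute)
  qed
  also have "\<dots> = (\<integral>\<^sup>+x. g (- x) \<partial>frame_measure I e 0) * (\<integral>\<^sup>+y. f y \<partial>frame_measure J e' 0)"
    using P0[of "\<lambda>x. g (- x)"] by (simp add: nn_integral_cmult Q0 mult.commute)
  finally show ?thesis .
qed

text \<open>Dual functionals, which read off coordinates with respect to the family. Injectivity
  turns an equality \<open>e i = e j\<close> of vectors into one of indices.\<close>

lemma independent_image_functional:
  fixes e :: "'i \<Rightarrow> 'a::euclidean_space"
  assumes "inj_on e I" "independent (e ` I)"
  obtains h :: "'i \<Rightarrow> 'a \<Rightarrow> real" where "\<And>i. linear (h i)"
    "\<And>i j. i \<in> I \<Longrightarrow> j \<in> I \<Longrightarrow> h i (e j) = (if i = j then 1 else 0)"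
proof -
  have "\<exists>h. linear h \<and> (\<forall>x\<in>e ` I. h x = (if x = e i then 1 else (0::real)))" for i
    by (rule linear_independent_extend[OF assms(2)])
  then obtain h where "\<And>i. linear (h i)" and
    h: "\<And>i x. x \<in> e ` I \<Longrightarrow> h i x = (if x = e i then 1 else (0::real))" by metis
  moreover have "h i (e j) = (if i = j then 1 else 0)" if "i \<in> I" "j \<in> I" for i j
    using h[of "e j" i] that assms(1) by (auto simp: inj_on_def)
  ultimately show ?thesis using that by blast
qed

text \<open>The set where all dual functionals lie in [0,1] pulls back along the parametrization to
  the unit cube of the product space. A set of measure one normalizes the comparison of two
  frames.\<close>

lemma frame_measure_unit_cube:
  fixes e :: "'i \<Rightarrow> 'a::euclidean_space"
  assumes I: "finite I" and e: "inj_on e I" "independent (e ` I)"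
  obtains K where "K \<in> sets borel" "emeasure (frame_measure I e 0) K = 1"
proof -
  interpret product_sigma_finite "\<lambda>_::'i. lborel :: real measure" by standard
  obtain h :: "'i \<Rightarrow> 'a \<Rightarrow> real" where lin: "\<And>i. linear (h i)"
    and h: "\<And>i j. i \<in> I \<Longrightarrow> j \<in> I \<Longrightarrow> h i (e j) = (if i = j then 1 else 0)"
    using independent_image_functional[OF e] by blast
  define K where "K = (\<Inter>i\<in>I. h i -` {0..1})"
  have "continuous_on UNIV (h i)" for i
    using lin by (simp add: linear_continuous_on linear_conv_bounded_linear)
  then have closed: "closed K"
    unfolding K_def by (intro closed_INT ballI closed_vimage) auto
  have coord: "h i (\<Sum>j\<in>I. t j *\<^sub>R e j) = t i" if "i \<in> I" for i t
    using that I by (simp add: linear_sum[OF lin] linear_scale[OF lin] h if_distrib[of "\<lambda>x. _ * x"] cong: if_cong)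
  have "emeasure (frame_measure I e 0) K =
    emeasure (\<Pi>\<^sub>M i\<in>I. lborel) ((\<lambda>t. 0 + (\<Sum>i\<in>I. t i *\<^sub>R e i)) -` K \<inter> space (\<Pi>\<^sub>M i\<in>I. lborel))"
    unfolding frame_measure_def using closed by (intro emeasure_distr frame_map_measurable) auto
  also have "(\<lambda>t. 0 + (\<Sum>i\<in>I. t i *\<^sub>R e i)) -` K \<inter> space (\<Pi>\<^sub>M i\<in>I. (lborel :: real measure)) =
      (\<Pi>\<^sub>E i\<in>I. {0..1})"
    by (auto simp: K_def coord space_PiM PiE_def Pi_def)
  also have "emeasure (\<Pi>\<^sub>M i\<in>I. (lborel :: real measure)) (\<Pi>\<^sub>E i\<in>I. {0..1}) = (\<Prod>i\<in>I. emeasure (lborel :: real measure) {0..1})"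
    using I by (intro emeasure_PiM) auto
  finally have "emeasure (frame_measure I e 0) K = 1" by simp
  with closed show ?thesis by (intro that[of K]) auto
qed

text \<open>If \<open>g\<close> in \<open>frame_measure_exchange\<close> is the indicator of a set
  of measure one for the second frame, the identity says that the first measure is a constant
  multiple of the second.\<close>

lemma frame_measure_unique:
  fixes e :: "'i \<Rightarrow> 'a::euclidean_space" and e' :: "'j \<Rightarrow> 'a"
  assumes I: "finite I" "inj_on e I" "independent (e ` I)"
    and J: "finite J" "inj_on e' J" "independent (e' ` J)"
    and span: "span (e ` I) = span (e' ` J)" and pq: "p - q \<in> span (e ` I)"
  obtains c :: real where "0 < c" "frame_measure I e p = density (frame_measure J e' q) (\<lambda>_. ennreal c)"
proof -
  obtain K where K [measurable]: "K \<in> sets borel" and K1: "emeasure (frame_measure I e 0) K = 1"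
    using frame_measure_unit_cube[OF I] .
  obtain K' where K' [measurable]: "K' \<in> sets borel" and K'1: "emeasure (frame_measure J e' 0) K' = 1"
    using frame_measure_unit_cube[OF J] .
  \<comment> \<open>The constant is the first measure of the reflected set of all \<open>- x\<close>
    with \<open>x\<close> in \<open>K'\<close>.\<close>
  define C where "C = (\<integral>\<^sup>+x. indicator K' (- x) \<partial>frame_measure I e 0)"
  have C: "emeasure (frame_measure I e 0) A = C * emeasure (frame_measure J e' 0) A"
    if [measurable]: "A \<in> sets borel" for A
    using frame_measure_exchange[OF I(1) J(1) span, of "indicator A" "indicator K'"]
    by (simp add: K'1 C_def)
  have "C * emeasure (frame_measure J e' 0) K = 1" using C[OF K] K1 by simp
  \<comment> \<open>A product equal to 1 excludes both extreme values of \<open>C\<close>: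
    \<open>top\<close> times anything is 0 or \<open>top\<close>.\<close>
  then have "C \<noteq> 0" "C \<noteq> top" by (auto simp: ennreal_top_mult split: if_splits)
  then obtain c where c: "0 < c" "C = ennreal c"
    by (cases C) (auto simp: ennreal_eq_0_iff less_le)
  show ?thesis
  proof (rule that[OF c(1)], rule measure_eqI)
    fix A assume "A \<in> sets (frame_measure I e p)"
    then have [measurable]: "A \<in> sets borel" by simp
    have A: "(\<lambda>x. p + x) -` A \<in> sets borel"
      using measurable_sets_borel[of "\<lambda>x. p + x" borel A] by auto
    \<comment> \<open>With \<open>p\<close> as common base point, one shift reduces both measures to
      the case of the origin.\<close>
    have "frame_measure J e' q = frame_measure J e' p"
      using frame_measure_translate[OF J(1), of p q e'] pq span by simp
    then show "emeasure (frame_measure I e p) A = emeasure (density (frame_measure J e' q) (\<lambda>_. ennreal c)) A"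
      using C[OF A] by (simp add: emeasure_frame_measure_shift[of _ _ _ p] emeasure_density_const c(2))
  qed simp
qed

section \<open>Integrals over simplices\<close>

text \<open>Values outside \<open>I\<close> are unconstrained, so statements about measurability and
  volume intersect with the space of the product measure.\<close>

definition unit_simplex :: "'i set \<Rightarrow> ('i \<Rightarrow> real) set" where
  "unit_simplex I = {t. (\<forall>i\<in>I. 0 \<le> t i) \<and> (\<Sum>i\<in>I. t i) \<le> 1}"

text \<open>The integral over the simplex with vertices \<open>p\<close> and \<open>p + e i\<close>,
  taken in edge coordinates without the Jacobian factor. For empty \<open>I\<close> it is the value
  \<open>f p\<close>.\<close>

definition simplex_integral ::
  "'i set \<Rightarrow> ('i \<Rightarrow> 'a::euclidean_space) \<Rightarrow> 'a \<Rightarrow> ('a \<Rightarrow> real) \<Rightarrow> real" where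
  "simplex_integral I e p f =
     (\<integral>t. indicator (unit_simplex I) t * f (p + (\<Sum>i\<in>I. t i *\<^sub>R e i)) \<partial>(\<Pi>\<^sub>M i\<in>I. lborel))"

lemma indicator_unit_simplex_measurable [measurable]:
  assumes "finite I"
  shows "(indicator (unit_simplex I) :: _ \<Rightarrow> real) \<in> borel_measurable (\<Pi>\<^sub>M i\<in>I. (lborel :: real measure))"
proof -
  have "unit_simplex I \<inter> space (\<Pi>\<^sub>M i\<in>I. (lborel :: real measure)) =
      Pi\<^sub>E I (\<lambda>_. {0..}) \<inter> (\<lambda>t. \<Sum>i\<in>I. t i) -` {..1} \<inter> space (\<Pi>\<^sub>M i\<in>I. (lborel :: real measure))"
    by (auto simp: unit_simplex_def space_PiM)
  also have "\<dots> \<in> sets (\<Pi>\<^sub>M i\<in>I. lborel)"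
    using assms by measurable
  finally show ?thesis by (simp add: borel_measurable_indicator_iff)
qed

lemma emeasure_unit_simplex:
  assumes "finite I"
  shows "emeasure (\<Pi>\<^sub>M i\<in>I. (lborel :: real measure)) (unit_simplex I \<inter> space (\<Pi>\<^sub>M i\<in>I. lborel)) =
    ennreal (1 / fact (card I))"
  using emeasure_std_simplex_aux[OF assms, of 1] by (simp add: unit_simplex_def)

lemma unit_simplex_convex_hull:
  fixes e :: "'i \<Rightarrow> 'a::euclidean_space"
  assumes I: "finite I" and t: "t \<in> unit_simplex I"
  shows "p + (\<Sum>i\<in>I. t i *\<^sub>R e i) \<in> convex hull (insert p ((\<lambda>i. p + e i) ` I))" (is "_ \<in> ?C")
proof -
  have "(1 - (\<Sum>i\<in>I. t i)) *\<^sub>R p + (\<Sum>i\<in>I. t i *\<^sub>R (p + e i)) = p + (\<Sum>i\<in>I. t i *\<^sub>R e i)"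
    by (simp add: scaleR_right_distrib sum.distrib scaleR_left_diff_distrib scaleR_sum_left)
  \<comment> \<open>\<open>None\<close> stands for \<open>p\<close> with the leftover weight; the
    option type keeps the indices apart even where the points coincide.\<close>
  moreover have "(\<Sum>j\<in>insert None (Some ` I). (case j of None \<Rightarrow> 1 - (\<Sum>i\<in>I. t i) | Some i \<Rightarrow> t i) *\<^sub>R
      (case j of None \<Rightarrow> p | Some i \<Rightarrow> p + e i)) \<in> ?C"
    using I t
    by (intro convex_sum) (auto simp: unit_simplex_def sum.reindex intro!: hull_inc)
  moreover have "(\<Sum>j\<in>insert None (Some ` I). (case j of None \<Rightarrow> 1 - (\<Sum>i\<in>I. t i) | Some i \<Rightarrow> t i) *\<^sub>R
      (case j of None \<Rightarrow> p | Some i \<Rightarrow> p + e i)) = (1 - (\<Sum>i\<in>I. t i)) *\<^sub>R p + (\<Sum>i\<in>I. t i *\<^sub>R (p + e i))"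
    using I by (simp add: sum.reindex)
  ultimately show ?thesis by simp
qed

text \<open>A continuous function is bounded on the compact convex hull of the vertices, and the
  unit simplex has finite volume.\<close>

lemma simplex_integrable:
  fixes e :: "'i \<Rightarrow> 'a::euclidean_space"
  assumes I: "finite I" and f: "continuous_on UNIV f"
  shows "integrable (\<Pi>\<^sub>M i\<in>I. lborel)
    (\<lambda>t. indicator (unit_simplex I) t * (f (p + (\<Sum>i\<in>I. t i *\<^sub>R e i)) :: real))"
proof -
  let ?P = "\<Pi>\<^sub>M i\<in>I. (lborel :: real measure)"
  have [measurable]: "f \<in> borel_measurable borel" using f by (rule borel_measurable_continuous_onI)
  have "compact (convex hull (insert p ((\<lambda>i. p + e i) ` I)))"
    using I by (intro finite_imp_compact_convex_hull) auto
  then have "bounded (f ` (convex hull (insert p ((\<lambda>i. p + e i) ` I))))"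
    using f by (intro compact_imp_bounded compact_continuous_image) (auto intro: continuous_on_subset)
  then obtain B where B: "\<And>x. x \<in> convex hull (insert p ((\<lambda>i. p + e i) ` I)) \<Longrightarrow> norm (f x) \<le> B"
    by (auto simp: bounded_iff)
  show ?thesis
  proof (rule integrableI_bounded_set)
    show "unit_simplex I \<inter> space ?P \<in> sets ?P"
      using indicator_unit_simplex_measurable[OF I] by (simp only: borel_measurable_indicator_iff)
    show "emeasure ?P (unit_simplex I \<inter> space ?P) < \<infinity>"
      using emeasure_unit_simplex[OF I] by simp
    show "AE t in ?P. t \<in> unit_simplex I \<inter> space ?P \<longrightarrow>
      norm (indicator (unit_simplex I) t * f (p + (\<Sum>i\<in>I. t i *\<^sub>R e i))) \<le> B"
      using B unit_simplex_convex_hull[OF I] by (intro AE_I2) auto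
    note indicator_unit_simplex_measurable[OF I, measurable]
    show "(\<lambda>t. indicator (unit_simplex I) t * f (p + (\<Sum>i\<in>I. t i *\<^sub>R e i))) \<in> borel_measurable ?P"
      by measurable
  qed auto
qed

lemma simplex_integral_add:
  assumes "finite I" "continuous_on UNIV f" "continuous_on UNIV g"
  shows "simplex_integral I e p (\<lambda>x. f x + g x) = simplex_integral I e p f + simplex_integral I e p g"
  unfolding simplex_integral_def distrib_left
  by (rule Bochner_Integration.integral_add) (intro simplex_integrable assms)+

lemma simplex_integral_cmult:
  "simplex_integral I e p (\<lambda>x. c * f x) = c * simplex_integral I e p f"
  unfolding simplex_integral_def by (simp add: mult.left_commute)

text \<open>Describes the slices needed for Fubini: an interval over each point of the smaller
  simplex, and nothing elsewhere.\<close>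

lemma unit_simplex_insert_upd:
  assumes "finite I" "b \<notin> I"
  shows "t(b := y) \<in> unit_simplex (insert b I) \<longleftrightarrow>
    t \<in> unit_simplex I \<and> y \<in> {0..1 - (\<Sum>i\<in>I. t i)}"
proof -
  have "(\<Sum>i\<in>I. (t(b := y)) i) = (\<Sum>i\<in>I. t i)"
    using assms by (intro sum.cong) auto
  then show ?thesis using assms by (auto simp: unit_simplex_def)
qed

text \<open>Integrate over the coordinate of \<open>b\<close> first. On each slice the fundamental
  theorem of calculus leaves two endpoint values: the lower endpoints sweep the facet that omits
  \<open>p + e b\<close>, the upper ones the facet opposite to \<open>p\<close>.\<close>

lemma simplex_integral_dir_deriv:
  fixes e :: "'i \<Rightarrow> real^'n"
  assumes I: "finite I" "b \<notin> I" and f: "\<And>x. f differentiable at x"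
    and df: "continuous_on UNIV (dir_deriv (e b) f)"
  shows "simplex_integral (insert b I) e p (dir_deriv (e b) f) =
    simplex_integral I (\<lambda>i. e i - e b) (p + e b) f - simplex_integral I e p f"
proof -
  interpret product_sigma_finite "\<lambda>_::'i. lborel :: real measure" by standard
  let ?P = "\<Pi>\<^sub>M i\<in>I. (lborel :: real measure)"
  let ?x = "\<lambda>t. p + (\<Sum>i\<in>I. t i *\<^sub>R e i)"
  have cf: "continuous_on UNIV f"
    using f by (auto intro!: continuous_at_imp_continuous_on differentiable_imp_continuous_within)
  have upd: "p + (\<Sum>i\<in>insert b I. (t(b := y)) i *\<^sub>R e i) = ?x t + y *\<^sub>R e b" for t y
  proof -
    have "(\<Sum>i\<in>I. (t(b := y)) i *\<^sub>R e i) = (\<Sum>i\<in>I. t i *\<^sub>R e i)"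
      using I by (intro sum.cong) auto
    then show ?thesis using I by (simp add: add_ac)
  qed
  have deriv: "((\<lambda>y. f (z + y *\<^sub>R e b)) has_real_derivative dir_deriv (e b) f (z + y *\<^sub>R e b)) (at y)"
    for z y
  proof -
    have "(f has_derivative frechet_derivative f (at (z + y *\<^sub>R e b))) (at (z + y *\<^sub>R e b))"
      using f frechet_derivative_works by blast
    moreover have "((\<lambda>y. z + y *\<^sub>R e b) has_derivative (\<lambda>h. h *\<^sub>R e b)) (at y)"
      by (auto intro!: derivative_eq_intros)
    ultimately have "((\<lambda>y. f (z + y *\<^sub>R e b)) has_derivative
        (\<lambda>h. frechet_derivative f (at (z + y *\<^sub>R e b)) (h *\<^sub>R e b))) (at y)"
      using has_derivative_compose by fast
    moreover have "linear (frechet_derivative f (at (z + y *\<^sub>R e b)))"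
      using f by (rule linear_frechet_derivative)
    ultimately show ?thesis
      by (simp add: has_field_derivative_def dir_deriv_def linear_scale mult.commute[of _ "frechet_derivative f _ _"])
  qed
  have inner: "(\<integral>y. indicator (unit_simplex (insert b I)) (t(b := y)) *
      dir_deriv (e b) f (p + (\<Sum>i\<in>insert b I. (t(b := y)) i *\<^sub>R e i)) \<partial>lborel) =
    indicator (unit_simplex I) t * f (p + e b + (\<Sum>i\<in>I. t i *\<^sub>R (e i - e b))) -
    indicator (unit_simplex I) t * f (?x t)" (is "?lhs t = ?rhs t") for t
  proof (cases "t \<in> unit_simplex I")
    case True
    define s where "s = 1 - (\<Sum>i\<in>I. t i)"
    have s: "0 \<le> s" using True by (auto simp: unit_simplex_def s_def)
    have ind: "indicator (unit_simplex (insert b I)) (t(b := y)) = (indicator {0..s} y :: real)" for y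
      using True by (simp only: indicator_def unit_simplex_insert_upd[OF I] s_def simp_thms)
    have "?lhs t = (\<integral>y. dir_deriv (e b) f (?x t + y *\<^sub>R e b) * indicator {0..s} y \<partial>lborel)"
      unfolding upd ind by (simp add: mult.commute)
    also have "\<dots> = f (?x t + s *\<^sub>R e b) - f (?x t + 0 *\<^sub>R e b)"
    proof (rule integral_FTC_Icc_real[OF s deriv])
      fix y
      have "isCont (dir_deriv (e b) f) (?x t + y *\<^sub>R e b)"
        using df by (simp add: continuous_on_eq_continuous_at)
      moreover have "isCont (\<lambda>y. ?x t + y *\<^sub>R e b) y"
        by (intro continuous_intros)
      ultimately show "isCont (\<lambda>y. dir_deriv (e b) f (?x t + y *\<^sub>R e b)) y"
        by (rule isCont_o2[rotated])
    qed
    \<comment> \<open>The upper endpoint has weight \<open>s\<close> on \<open>p + e b\<close>,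
      hence it is a point of the opposite facet, written with base vertex \<open>p + e b\<close> and
      edges \<open>e i - e b\<close>.\<close>
    also have "?x t + s *\<^sub>R e b = p + e b + (\<Sum>i\<in>I. t i *\<^sub>R (e i - e b))"
      by (simp add: s_def scaleR_right_diff_distrib scaleR_left_diff_distrib sum_subtractf scaleR_sum_left)
    finally have L: "?lhs t = f (p + e b + (\<Sum>i\<in>I. t i *\<^sub>R (e i - e b))) - f (?x t + 0 *\<^sub>R e b)" .
    show ?thesis unfolding L using True by simp
  next
    case False
    then show ?thesis by (simp add: unit_simplex_insert_upd[OF I])
  qed
  have "simplex_integral (insert b I) e p (dir_deriv (e b) f) = (\<integral>t. ?lhs t \<partial>?P)"
    unfolding simplex_integral_def
    by (rule product_integral_insert[OF I simplex_integrable]) (use I df in auto)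
  also have "\<dots> = (\<integral>t. ?rhs t \<partial>?P)" unfolding inner ..
  also have "\<dots> = simplex_integral I (\<lambda>i. e i - e b) (p + e b) f - simplex_integral I e p f"
    unfolding simplex_integral_def
    by (intro Bochner_Integration.integral_diff simplex_integrable I cf)
  finally show ?thesis .
qed

text \<open>The vertices other than \<open>a\<close> index their own edges. For affinely independent
  \<open>S\<close> containing \<open>a\<close> this is, up to a positive factor, the integral over
  \<open>convex hull S\<close>.\<close>

abbreviation vertex_integral :: "(real^'n) set \<Rightarrow> real^'n \<Rightarrow> (real^'n \<Rightarrow> real) \<Rightarrow> real" where
  "vertex_integral S a \<equiv> simplex_integral (S - {a}) (\<lambda>b. b - a) a"

text \<open>Since \<open>(c - a) - (b - a) = c - b\<close>, the edges of the facet opposite to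
  \<open>a\<close> are again those leaving one of its vertices, so both boundary terms are vertex
  integrals.\<close>

lemma vertex_integral_dir_deriv:
  assumes S: "finite S" "a \<in> S" "b \<in> S" "a \<noteq> b" and f: "\<And>x. f differentiable at x"
    and df: "continuous_on UNIV (dir_deriv (b - a) f)"
  shows "vertex_integral S a (dir_deriv (b - a) f) =
    vertex_integral (S - {a}) b f - vertex_integral (S - {b}) a f"
proof -
  have "S - {a} = insert b (S - {a} - {b})" "S - {b} - {a} = S - {a} - {b}"
    using S by auto
  with simplex_integral_dir_deriv[of "S - {a} - {b}" b f "\<lambda>b. b - a" a] S(1) f df
  show ?thesis by simp
qed

section \<open>Convex hulls of affinely independent points in edge coordinates\<close>

lemma edges_independent:
  assumes "\<not> affine_dependent S" "a \<in> S"
  shows "inj_on (\<lambda>b. b - a) (S - {a})" "independent ((\<lambda>b. b - a) ` (S - {a}))"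
  using assms affine_dependent_iff_dependent2[of a S] by (auto simp: inj_on_def algebra_simps)

lemma independent_coordinates_unique:
  fixes e :: "'i \<Rightarrow> 'a::euclidean_space"
  assumes I: "finite I" "inj_on e I" "independent (e ` I)"
    and eq: "(\<Sum>i\<in>I. s i *\<^sub>R e i) = (\<Sum>i\<in>I. t i *\<^sub>R e i)" and i: "i \<in> I"
  shows "s i = t i"
proof -
  obtain h :: "'i \<Rightarrow> 'a \<Rightarrow> real" where lin: "\<And>i. linear (h i)"
    and h: "\<And>i j. i \<in> I \<Longrightarrow> j \<in> I \<Longrightarrow> h i (e j) = (if i = j then 1 else 0)"
    using independent_image_functional[OF I(2,3)] by blast
  have "h i (\<Sum>j\<in>I. t j *\<^sub>R e j) = t i" for t
    using i I(1) by (simp add: linear_sum[OF lin] linear_scale[OF lin] h if_distrib[of "\<lambda>x. _ * x"] cong: if_cong)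
  then show ?thesis using eq by metis
qed

text \<open>By independence of the edges, edge coordinates are the barycentric coordinates with the
  weight of \<open>a\<close> dropped. That this weight is nonnegative is the condition that the
  others sum to at most 1.\<close>

lemma convex_hull_edge_coordinates:
  fixes S :: "'a::euclidean_space set"
  assumes S: "\<not> affine_dependent S" "a \<in> S"
  shows "a + (\<Sum>b\<in>S - {a}. t b *\<^sub>R (b - a)) \<in> convex hull S \<longleftrightarrow> t \<in> unit_simplex (S - {a})"
proof
  have fin: "finite S" using S(1) by (rule aff_independent_finite)
  assume "t \<in> unit_simplex (S - {a})"
  from unit_simplex_convex_hull[OF _ this, of a "\<lambda>b. b - a"] fin S(2)
  show "a + (\<Sum>b\<in>S - {a}. t b *\<^sub>R (b - a)) \<in> convex hull S" by (simp add: insert_absorb)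
next
  have fin: "finite S" using S(1) by (rule aff_independent_finite)
  assume "a + (\<Sum>b\<in>S - {a}. t b *\<^sub>R (b - a)) \<in> convex hull S"
  then obtain u where u: "\<And>b. b \<in> S \<Longrightarrow> 0 \<le> u b" "sum u S = 1"
    and eq: "(\<Sum>b\<in>S. u b *\<^sub>R b) = a + (\<Sum>b\<in>S - {a}. t b *\<^sub>R (b - a))"
    using fin by (auto simp: convex_hull_finite)
  have "(\<Sum>b\<in>S - {a}. u b *\<^sub>R (b - a)) = (\<Sum>b\<in>S. u b *\<^sub>R (b - a))"
    using fin S(2) by (simp add: sum.remove[of S a])
  also have "\<dots> = (\<Sum>b\<in>S. u b *\<^sub>R b) - a"
    using u(2) by (simp add: scaleR_right_diff_distrib sum_subtractf flip: scaleR_sum_left)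
  finally have "(\<Sum>b\<in>S - {a}. t b *\<^sub>R (b - a)) = (\<Sum>b\<in>S - {a}. u b *\<^sub>R (b - a))"
    using eq by simp
  then have t: "t b = u b" if "b \<in> S - {a}" for b
    using independent_coordinates_unique[OF _ edges_independent[OF S], of t u b] fin that by auto
  have "sum t (S - {a}) = 1 - u a"
    using t u(2) fin S(2) by (simp add: sum.remove[of S a])
  then show "t \<in> unit_simplex (S - {a})" using t u S(2) by (auto simp: unit_simplex_def)
qed

text \<open>Uniqueness of the measure allows passing to the frame of edges, where the hull becomes
  the unit simplex. The measure must be shown nonzero because a division by 0 would give 0 and say
  nothing about the integral.\<close>

lemma frame_integral_convex_hull:
  fixes S :: "(real^'n) set"
  assumes S: "\<not> affine_dependent S" "a \<in> S"
    and I: "finite I" "inj_on e I" "independent (e ` I)"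
    and span: "span (e ` I) = span ((\<lambda>b. b - a) ` (S - {a}))" and p: "p - a \<in> span (e ` I)"
  obtains c where "0 < c" "measure (frame_measure I e p) (convex hull S) \<noteq> 0"
    "\<And>f. f \<in> borel_measurable borel \<Longrightarrow>
       (LINT x:convex hull S|frame_measure I e p. f x) = c * vertex_integral S a f"
proof -
  have fin: "finite S" using S(1) by (rule aff_independent_finite)
  let ?J = "S - {a}" and ?d = "\<lambda>b. b - a"
  let ?P = "\<Pi>\<^sub>M i\<in>?J. (lborel :: real measure)"
  obtain c where c: "0 < c"
    and eq: "frame_measure I e p = density (frame_measure ?J ?d a) (\<lambda>_. ennreal c)"
    using frame_measure_unique[OF I _ edges_independent[OF S] span p] fin by blast
  have K [measurable]: "convex hull S \<in> sets borel"
    using fin by (intro borel_closed compact_imp_closed finite_imp_compact_convex_hull)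
  have LINT: "(LINT x:convex hull S|frame_measure I e p. f x) = c * vertex_integral S a f"
    if [measurable]: "f \<in> borel_measurable borel" for f
  proof -
    have "(LINT x:convex hull S|frame_measure I e p. f x) =
      (\<integral>x. c * (indicator (convex hull S) x * f x) \<partial>frame_measure ?J ?d a)"
      unfolding eq set_lebesgue_integral_def using c
      by (subst integral_density) auto
    also have "\<dots> = (\<integral>t. c * (indicator (convex hull S) (a + (\<Sum>b\<in>?J. t b *\<^sub>R ?d b)) *
        f (a + (\<Sum>b\<in>?J. t b *\<^sub>R ?d b))) \<partial>?P)"
      unfolding frame_measure_def by (rule integral_distr) auto
    also have "\<dots> = c * vertex_integral S a f"
      using convex_hull_edge_coordinates[OF S]
      by (simp add: simplex_integral_def indicator_def)
    finally show ?thesis .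
  qed
  \<comment> \<open>The case of the constant function 1: the vertex integral is the volume of the
    unit simplex, one over a factorial.\<close>
  have "measure (frame_measure I e p) (convex hull S) = (LINT x:convex hull S|frame_measure I e p. 1)"
    by (simp add: set_lebesgue_integral_def)
  also have "\<dots> = c * vertex_integral S a (\<lambda>_. 1)" by (rule LINT) simp
  also have "vertex_integral S a (\<lambda>_. 1) = measure ?P (unit_simplex ?J \<inter> space ?P)"
    by (simp add: simplex_integral_def)
  also have "\<dots> = 1 / fact (card ?J)"
    using emeasure_unit_simplex[of ?J] fin by (simp add: measure_def)
  finally have "measure (frame_measure I e p) (convex hull S) \<noteq> 0" using c by simp
  with c show ?thesis using LINT by (rule that)
qed

lemma tangent_space_convex_hull:
  fixes S :: "'a::euclidean_space set"
  assumes "a \<in> S"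
  shows "tangent_space (convex hull S) = span ((\<lambda>b. b - a) ` (S - {a}))"
proof -
  have aff: "affine hull S = (\<lambda>x. a + x) ` span ((\<lambda>b. b - a) ` (S - {a}))"
    using affine_hull_span2[OF assms] by simp
  have "{x - y | x y. x \<in> convex hull S \<and> y \<in> convex hull S} \<subseteq> span ((\<lambda>b. b - a) ` (S - {a}))"
  proof clarify
    fix x y assume "x \<in> convex hull S" "y \<in> convex hull S"
    then have "x \<in> affine hull S" "y \<in> affine hull S" using convex_hull_subset_affine_hull by auto
    then obtain u w where "x = a + u" "y = a + w" "u \<in> span ((\<lambda>b. b - a) ` (S - {a}))"
      "w \<in> span ((\<lambda>b. b - a) ` (S - {a}))" unfolding aff by auto
    then show "x - y \<in> span ((\<lambda>b. b - a) ` (S - {a}))" by (simp add: span_diff)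
  qed
  moreover have "(\<lambda>b. b - a) ` (S - {a}) \<subseteq> {x - y | x y. x \<in> convex hull S \<and> y \<in> convex hull S}"
    using assms by (auto intro: hull_inc)
  ultimately show ?thesis
    unfolding tangent_space_def by (intro subset_antisym span_minimal span_mono subspace_span)
qed

text \<open>The choices inside \<open>flat_measure\<close> are harmless: any point of the hull and
  any orthonormal basis of the tangent space meet the hypotheses of
  \<open>frame_integral_convex_hull\<close>.\<close>

lemma flat_integral_convex_hull:
  fixes S :: "(real^'n) set"
  assumes S: "\<not> affine_dependent S" "a \<in> S"
  obtains c where "0 < c" "measure (flat_measure (convex hull S)) (convex hull S) \<noteq> 0"
    "\<And>f. f \<in> borel_measurable borel \<Longrightarrow>
       (LINT x:convex hull S|flat_measure (convex hull S). f x) = c * vertex_integral S a f"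
proof -
  define V where "V = tangent_space (convex hull S)"
  define p where "p = (SOME p. p \<in> convex hull S)"
  define B where "B = (SOME B. orthonormal_basis_of B V)"
  have V: "V = span ((\<lambda>b. b - a) ` (S - {a}))"
    unfolding V_def using S(2) by (rule tangent_space_convex_hull)
  have a: "a \<in> convex hull S" using S(2) by (rule hull_inc)
  then have p: "p \<in> convex hull S" unfolding p_def by (rule someI)
  have "subspace V" unfolding V by (rule subspace_span)
  then obtain B0 where "pairwise orthogonal B0" "\<And>x. x \<in> B0 \<Longrightarrow> norm x = 1" "span B0 = V"
    using orthonormal_basis_subspace by metis
  then have "orthonormal_basis_of B0 V" by (simp add: orthonormal_basis_of_def)
  then have B: "orthonormal_basis_of B V" unfolding B_def by (rule someI)
  then have ind: "independent B"
    unfolding orthonormal_basis_of_def by (intro pairwise_orthogonal_independent) auto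
  have "p - a \<in> V"
    unfolding V_def tangent_space_def using p a by (intro span_base) auto
  moreover have "span B = V" using B by (simp add: orthonormal_basis_of_def)
  moreover have "flat_measure (convex hull S) = frame_measure B (\<lambda>b. b) p"
    by (simp add: flat_measure_def frame_measure_def p_def B_def V_def Let_def)
  ultimately show ?thesis
    using frame_integral_convex_hull[OF S, of B "\<lambda>b. b" p thesis] that ind V
    by (simp add: independent_imp_finite)
qed

text \<open>The counterpart for \<open>dof_mean\<close>, which integrates against
  \<open>lborel\<close>: this is the measure of the standard frame at the origin, and the edges of a
  full-dimensional simplex span the whole space.\<close>

lemma lborel_integral_convex_hull:
  fixes S :: "(real^'n) set"
  assumes S: "\<not> affine_dependent S" "a \<in> S" and card: "card S = CARD('n) + 1"
  obtains c where "0 < c" "measure lborel (convex hull S) \<noteq> 0"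
    "\<And>f. f \<in> borel_measurable borel \<Longrightarrow>
       (LINT x:convex hull S|lborel. f x) = c * vertex_integral S a f"
proof -
  have "lborel = frame_measure Basis (\<lambda>b. b) (0 :: real^'n)"
    unfolding frame_measure_def by (subst lborel_eq) simp
  moreover have "span ((\<lambda>b. b - a) ` (S - {a})) = UNIV"
  proof -
    have "dim ((\<lambda>b. b - a) ` (S - {a})) = CARD('n)"
      using edges_independent[OF S] card S(2)
      by (simp add: dim_eq_card_independent card_image)
    then show ?thesis by (simp flip: dim_eq_full)
  qed
  ultimately show ?thesis
    using frame_integral_convex_hull[OF S, of Basis "\<lambda>b. b" 0 thesis] that
    by (simp add: independent_Basis)
qed

section \<open>Directional derivatives of polynomials\<close>

text \<open>Passes to the inductively defined polynomial functions, for which the calculus rules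
  below are obtained by structural induction.\<close>

lemma polys_imp_real_polynomial_function:
  fixes v :: "real^'n \<Rightarrow> real"
  assumes "v \<in> polys m"
  shows "real_polynomial_function v"
proof -
  obtain c where v: "v = (\<lambda>x. \<Sum>\<alpha> | (\<Sum>i\<in>UNIV. \<alpha> i) \<le> m. c \<alpha> * (\<Prod>i\<in>UNIV. x $ i ^ \<alpha> i))"
    using assms by (auto simp: polys_def)
  have "{\<alpha> :: 'n \<Rightarrow> nat. (\<Sum>i\<in>UNIV. \<alpha> i) \<le> m} \<subseteq> PiE UNIV (\<lambda>_. {..m})"
  proof
    fix \<alpha> :: "'n \<Rightarrow> nat" assume "\<alpha> \<in> {\<alpha>. (\<Sum>i\<in>UNIV. \<alpha> i) \<le> m}"
    moreover have "\<alpha> i \<le> (\<Sum>i\<in>UNIV. \<alpha> i)" for i by (rule member_le_sum) auto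
    ultimately show "\<alpha> \<in> PiE UNIV (\<lambda>_. {..m})" using order_trans by fastforce
  qed
  then have "finite {\<alpha> :: 'n \<Rightarrow> nat. (\<Sum>i\<in>UNIV. \<alpha> i) \<le> m}"
    by (rule finite_subset) (simp add: finite_PiE)
  then show ?thesis
    unfolding v
    by (intro real_polynomial_function_sum real_polynomial_function.intros(1,2,4)
        real_polynomial_function_prod real_polynomial_function_power
        bounded_linear_vec_nth) auto
qed

lemma real_polynomial_function_differentiable:
  assumes "real_polynomial_function f"
  shows "f differentiable at x"
  using assms
  by induction (auto intro: bounded_linear_imp_differentiable)

lemma real_polynomial_function_continuous:
  assumes "real_polynomial_function f"
  shows "continuous_on UNIV f"
  using real_polynomial_function_differentiable[OF assms]
  by (auto intro!: continuous_at_imp_continuous_on differentiable_imp_continuous_within)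

lemma dir_deriv_eq:
  assumes "(f has_derivative f') (at x)"
  shows "dir_deriv u f x = f' u"
  using frechet_derivative_at[OF assms] by (simp add: dir_deriv_def)

lemma dir_deriv_bounded_linear:
  assumes "bounded_linear f"
  shows "dir_deriv u f = (\<lambda>x. f u)"
  using dir_deriv_eq[OF bounded_linear_imp_has_derivative[OF assms]] by auto

lemma dir_deriv_const: "dir_deriv u (\<lambda>x. c) = (\<lambda>x. 0)"
  using dir_deriv_eq[OF has_derivative_const] by auto

lemma dir_deriv_add:
  assumes "real_polynomial_function f" "real_polynomial_function g"
  shows "dir_deriv u (\<lambda>x. f x + g x) = (\<lambda>x. dir_deriv u f x + dir_deriv u g x)"
  using assms[THEN real_polynomial_function_differentiable]
  by (auto simp: fun_eq_iff dir_deriv_def frechet_derivative_works intro!: dir_deriv_eq[unfolded dir_deriv_def] has_derivative_add)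

lemma dir_deriv_mult:
  assumes "real_polynomial_function f" "real_polynomial_function g"
  shows "dir_deriv u (\<lambda>x. f x * g x) = (\<lambda>x. f x * dir_deriv u g x + dir_deriv u f x * g x)"
  using assms[THEN real_polynomial_function_differentiable]
  by (auto simp: fun_eq_iff dir_deriv_def frechet_derivative_works intro!: dir_deriv_eq[unfolded dir_deriv_def] has_derivative_mult)

lemma real_polynomial_function_dir_deriv:
  assumes "real_polynomial_function f"
  shows "real_polynomial_function (dir_deriv u f)"
  using assms
  by induction (auto simp: dir_deriv_bounded_linear dir_deriv_const dir_deriv_add dir_deriv_mult)

text \<open>Symmetry of second derivatives; for polynomials it follows by structural induction, with
  the product rule applied twice in the case of products.\<close>

lemma dir_deriv_commute:
  assumes "real_polynomial_function f"
  shows "dir_deriv u (dir_deriv w f) = dir_deriv w (dir_deriv u f)"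
  using assms
proof induction
  case (linear f)
  then show ?case by (simp add: dir_deriv_bounded_linear dir_deriv_const)
next
  case (const c)
  then show ?case by (simp add: dir_deriv_const)
next
  case (add f g)
  then show ?case by (simp add: dir_deriv_add real_polynomial_function_dir_deriv)
next
  case (mult f g)
  then show ?case
    by (simp add: dir_deriv_mult dir_deriv_add real_polynomial_function_dir_deriv real_polynomial_function.intros(4) add_ac)
qed

lemma dir_deriv_direction:
  assumes "real_polynomial_function f"
  shows "dir_deriv (a *\<^sub>R u + w) f = (\<lambda>x. a * dir_deriv u f x + dir_deriv w f x)"
  using linear_frechet_derivative[OF real_polynomial_function_differentiable[OF assms]]
  by (auto simp: dir_deriv_def linear_add linear_scale)

section \<open>Iterated derivatives as lists of directions\<close>

lemma real_polynomial_function_foldr_dir_deriv: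
  assumes "real_polynomial_function f"
  shows "real_polynomial_function (foldr dir_deriv us f)"
  by (induction us) (auto intro: assms real_polynomial_function_dir_deriv)

text \<open>Directional derivatives preserve polynomial functions and commute on them, so only the
  multiset of directions matters.\<close>

lemma foldr_dir_deriv_cong_mset:
  assumes "real_polynomial_function f" "mset us = mset ws"
  shows "foldr dir_deriv us f = foldr dir_deriv ws f"
proof -
  have "fold dir_deriv (rev us) f = fold dir_deriv (rev ws) f"
    using assms
    by (intro fold_permuted_eq[where P = real_polynomial_function])
       (auto intro: real_polynomial_function_dir_deriv dir_deriv_commute)
  then show ?thesis by (simp add: foldr_conv_fold)
qed

lemma foldr_dir_deriv_funpow:
  "foldr (\<lambda>i. dir_deriv (\<nu> i) ^^ \<alpha> i) is f =
    foldr dir_deriv (concat (map (\<lambda>i. replicate (\<alpha> i) (\<nu> i)) is)) f"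
by (induction "is") simp_all

text \<open>Hides the chosen enumeration of the coordinates and keeps only the order of the
  derivative.\<close>

lemma partial_deriv_foldr:
  fixes \<beta> :: "'n::finite \<Rightarrow> nat"
  obtains us where "length us = (\<Sum>i\<in>UNIV. \<beta> i)" "\<And>v. partial_deriv \<beta> v = foldr dir_deriv us v"
proof -
  define js where "js = (SOME is. distinct is \<and> set is = (UNIV :: 'n set))"
  have "\<exists>is. distinct is \<and> set is = (UNIV :: 'n set)" using finite_distinct_list[OF finite_class.finite_UNIV] by auto
  then have js: "distinct js" "set js = UNIV" unfolding js_def by (metis (mono_tags, lifting) someI_ex)+
  show ?thesis
  proof (rule that)
    show "partial_deriv \<beta> v = foldr dir_deriv (concat (map (\<lambda>i. replicate (\<beta> i) (axis i 1)) js)) v" for v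
      unfolding partial_deriv_def foldr_dir_deriv_funpow js_def ..
    have "length (concat (map (\<lambda>i. replicate (\<beta> i) (axis i 1 :: real^'n)) js)) = sum_list (map \<beta> js)"
      by (simp add: length_concat o_def)
    then show "length (concat (map (\<lambda>i. replicate (\<beta> i) (axis i 1 :: real^'n)) js)) = (\<Sum>i\<in>UNIV. \<beta> i)"
      using js by (simp add: sum_list_distinct_conv_sum_set)
  qed
qed

lemma mset_concat_replicate_count:
  assumes "set is \<subseteq> set js" "distinct js"
  shows "mset (concat (map (\<lambda>j. replicate (count_list is j) j) js)) = mset is"
proof (rule multiset_eqI)
  fix i
  have "count (mset (concat (map (\<lambda>j. replicate (k j) j) js))) i = (if i \<in> set js then k i else 0)" for k
    using assms(2) by (induction js) auto
  then show "count (mset (concat (map (\<lambda>j. replicate (count_list is j) j) js))) i = count (mset is) i"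
    using assms(1) by (auto simp: count_mset count_list_0_iff)
qed

text \<open>Commuting derivatives can be sorted by index and collected into powers, whose exponents
  are the multiplicities in the list.\<close>

lemma foldr_dir_deriv_frame:
  assumes f: "real_polynomial_function f" and "is": "set is \<subseteq> {1..k}"
  shows "foldr dir_deriv (map \<nu> is) f = mixed_deriv k \<nu> (count_list is) f"
proof -
  have "mset is = mset (concat (map (\<lambda>j. replicate (count_list is j) j) [1..<Suc k]))"
    using "is" by (intro mset_concat_replicate_count[symmetric]) auto
  then have "mset (map \<nu> is) = mset (map \<nu> (concat (map (\<lambda>j. replicate (count_list is j) j) [1..<Suc k])))"
    by (metis mset_map)
  also have "map \<nu> (concat (map (\<lambda>j. replicate (count_list is j) j) [1..<Suc k])) =
      concat (map (\<lambda>j. replicate (count_list is j) (\<nu> j)) [1..<Suc k])"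
    by (simp add: map_concat o_def)
  finally show ?thesis
    unfolding mixed_deriv_def foldr_dir_deriv_funpow by (rule foldr_dir_deriv_cong_mset[OF f])
qed

section \<open>Derivatives and degrees of freedom\<close>

text \<open>Faces of a simplex correspond to subsets of its vertices, and a face has dimension one
  less than its number of vertices.\<close>

lemma sub_simplices_convex_hull:
  fixes C :: "(real^'n) set"
  assumes C: "\<not> affine_dependent C" and k: "k \<le> CARD('n)"
  shows "F \<in> sub_simplices (convex hull C) k \<longleftrightarrow>
    (\<exists>S\<subseteq>C. F = convex hull S \<and> card S + k = CARD('n) + 1)"
proof -
  have "(int CARD('n) - int k) simplex (convex hull S) \<longleftrightarrow> card S + k = CARD('n) + 1" if "S \<subseteq> C" for S
  proof -
    have S: "\<not> affine_dependent S" using C that affine_dependent_subset by blast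
    show ?thesis
    proof
      assume "(int CARD('n) - int k) simplex (convex hull S)"
      then have "aff_dim (convex hull S) = int CARD('n) - int k" by (rule aff_dim_simplex)
      moreover have "aff_dim S = int (card S) - 1" using S affine_independent_iff_card by blast
      ultimately show "card S + k = CARD('n) + 1" by (simp add: aff_dim_convex_hull)
    next
      assume "card S + k = CARD('n) + 1"
      then show "(int CARD('n) - int k) simplex (convex hull S)"
        using S by (intro simplex_convex_hull) auto
    qed
  qed
  then show ?thesis
    unfolding sub_simplices_def face_of_convex_hull_affine_independent[OF C] by auto
qed

section \<open>Degrees of freedom as vertex integrals\<close>

lemma real_polynomial_function_mixed_deriv:
  assumes "real_polynomial_function w"
  shows "real_polynomial_function (mixed_deriv k \<nu> \<alpha> w)"
  unfolding mixed_deriv_def foldr_dir_deriv_funpow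
  using assms by (rule real_polynomial_function_foldr_dir_deriv)

lemma dof_face_eq_0_iff:
  assumes S: "\<not> affine_dependent S" "a \<in> S" and w: "real_polynomial_function w"
  shows "dof_face \<nu> k (convex hull S) \<alpha> w = 0 \<longleftrightarrow>
    vertex_integral S a (mixed_deriv k (\<nu> (convex hull S)) \<alpha> w) = 0"
proof -
  have meas: "mixed_deriv k (\<nu> (convex hull S)) \<alpha> w \<in> borel_measurable borel"
    by (intro borel_measurable_continuous_onI real_polynomial_function_continuous
        real_polynomial_function_mixed_deriv w)
  show ?thesis
    by (rule flat_integral_convex_hull[OF S]) (use meas in \<open>simp add: dof_face_def\<close>)
qed

lemma dof_mean_eq_0_iff:
  fixes S :: "(real^'n) set"
  assumes S: "\<not> affine_dependent S" "a \<in> S" "card S = CARD('n) + 1"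
    and w: "real_polynomial_function w"
  shows "dof_mean (convex hull S) w = 0 \<longleftrightarrow> vertex_integral S a w = 0"
proof -
  have meas: "w \<in> borel_measurable borel"
    by (intro borel_measurable_continuous_onI real_polynomial_function_continuous w)
  show ?thesis
    by (rule lborel_integral_convex_hull[OF S]) (use meas in \<open>simp add: dof_mean_def\<close>)
qed

text \<open>A dimension count: the independent edges contribute \<open>card S - 1\<close>, the
  independent normals \<open>k\<close>, and these add up because the two families are
  orthogonal.\<close>

lemma span_edges_normals:
  fixes S :: "(real^'n) set"
  assumes S: "\<not> affine_dependent S" "a \<in> S" and card: "card S + k = CARD('n) + 1"
    and orth: "\<And>i t. i \<in> {1..k} \<Longrightarrow> t \<in> tangent_space (convex hull S) \<Longrightarrow> orthogonal (\<nu> i) t"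
    and ind: "inj_on \<nu> {1..k}" "independent (\<nu> ` {1..k})"
  shows "span ((\<lambda>b. b - a) ` (S - {a}) \<union> \<nu> ` {1..k}) = UNIV"
proof -
  have "dim ((\<lambda>b. b - a) ` (S - {a}) \<union> \<nu> ` {1..k}) =
    dim ((\<lambda>b. b - a) ` (S - {a})) + dim (\<nu> ` {1..k})"
  proof (rule dim_orthogonal_sum)
    fix x y assume "x \<in> (\<lambda>b. b - a) ` (S - {a})" "y \<in> \<nu> ` {1..k}"
    then have "x \<in> tangent_space (convex hull S)" "y \<in> \<nu> ` {1..k}"
      unfolding tangent_space_convex_hull[OF S(2)] by (auto intro: span_base)
    then have "orthogonal y x" using orth by blast
    then show "x \<bullet> y = 0" by (simp add: orthogonal_def inner_commute)
  qed
  also have "dim ((\<lambda>b. b - a) ` (S - {a})) = card S - 1"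
    using edges_independent[OF S] S(2) by (simp add: dim_eq_card_independent card_image)
  also have "dim (\<nu> ` {1..k}) = k"
    using ind by (simp add: dim_eq_card_independent card_image)
  finally have "dim ((\<lambda>b. b - a) ` (S - {a}) \<union> \<nu> ` {1..k}) = CARD('n)"
    using card S aff_independent_finite[OF S(1)] card_gt_0_iff[of S] by auto
  then show ?thesis by (simp flip: dim_eq_full)
qed

lemma vertex_integral_edge_deriv_eq_0:
  assumes S: "finite S" "a \<in> S" "b \<in> S" "a \<noteq> b" and h: "real_polynomial_function h"
    and zero: "vertex_integral (S - {a}) b h = 0" "vertex_integral (S - {b}) a h = 0"
  shows "vertex_integral S a (dir_deriv (b - a) h) = 0"
  using vertex_integral_dir_deriv[OF S, of h] zero real_polynomial_function_differentiable[OF h]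
    real_polynomial_function_continuous[OF real_polynomial_function_dir_deriv[OF h]]
  by simp

lemma vertex_integral_direction_span:
  assumes S: "finite S" and h: "real_polynomial_function h"
    and W: "\<And>u. u \<in> W \<Longrightarrow> vertex_integral S a (dir_deriv u h) = 0" and x: "x \<in> span W"
  shows "vertex_integral S a (dir_deriv x h) = 0"
  using x
proof (induction rule: span_induct_alt)
  case base
  \<comment> \<open>Writing the zero direction as -1 times itself plus itself shows that its
    derivative cancels.\<close>
  have "dir_deriv 0 h = (\<lambda>x. 0)"
    using dir_deriv_direction[OF h, of "-1" 0 0] by (auto simp: fun_eq_iff)
  then show ?case by (simp add: simplex_integral_def)
next
  case (step c y z)
  have cont: "continuous_on UNIV (dir_deriv u h)" for u
    by (intro real_polynomial_function_continuous real_polynomial_function_dir_deriv h)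
  have "vertex_integral S a (dir_deriv (c *\<^sub>R y + z) h) =
    c * vertex_integral S a (dir_deriv y h) + vertex_integral S a (dir_deriv z h)"
    unfolding dir_deriv_direction[OF h] using S
    by (subst simplex_integral_add) (auto intro!: continuous_intros cont simp: simplex_integral_cmult)
  then show ?case using step W by simp
qed

text \<open>Multilinearity of iterated derivatives in their directions: arbitrary directions are
  exchanged one at a time for elements of the spanning set \<open>W\<close>.\<close>

lemma vertex_integral_spanning_directions:
  assumes S: "finite S" and v: "real_polynomial_function v" and W: "span W = UNIV"
    and zero: "\<And>us. set us \<subseteq> W \<Longrightarrow> length us = r \<Longrightarrow> vertex_integral S a (foldr dir_deriv us v) = 0"
    and us: "length us = r"
  shows "vertex_integral S a (foldr dir_deriv us v) = 0"
proof -
  \<comment> \<open>Generalized to mixed lists: \<open>us\<close> is still arbitrary,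
    \<open>ws\<close> already lies in \<open>W\<close>. To treat the head of \<open>us\<close>, an
    element of \<open>W\<close> in its place is moved by commutation to \<open>ws\<close>, and the
    span closes the gap.\<close>
  have "vertex_integral S a (foldr dir_deriv (us @ ws) v) = 0"
    if "set ws \<subseteq> W" "length us + length ws = r" for us ws
    using that
  proof (induction us arbitrary: ws)
    case Nil
    then show ?case using zero by simp
  next
    case (Cons u us)
    let ?h = "foldr dir_deriv (us @ ws) v"
    have zero: "vertex_integral S a (dir_deriv y ?h) = 0" if "y \<in> W" for y
    proof -
      have "dir_deriv y ?h = foldr dir_deriv (y # us @ ws) v" by simp
      also have "\<dots> = foldr dir_deriv (us @ (y # ws)) v"
        by (rule foldr_dir_deriv_cong_mset[OF v]) simp
      finally have swap: "dir_deriv y ?h = foldr dir_deriv (us @ (y # ws)) v" .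
      show ?thesis unfolding swap by (rule Cons.IH) (use Cons.prems that in simp_all)
    qed
    have "u \<in> span W" using W by simp
    with S real_polynomial_function_foldr_dir_deriv[OF v] zero
    have "vertex_integral S a (dir_deriv u ?h) = 0"
      by (rule vertex_integral_direction_span)
    then show ?case by simp
  qed
  from this[of "[]" us] us show ?thesis by simp
qed

text \<open>Here \<open>j\<close> plays the part of \<open>L - l\<close>, which replaces truncated
  subtractions by one additive equation. The equation bounds \<open>j\<close> by \<open>L\<close>,
  so \<open>L - j\<close> is a legitimate level.\<close>

lemma dofs_face_memI:
  fixes T :: "(real^'n) set"
  assumes "F \<in> sub_simplices T k" "1 \<le> k" "k \<le> CARD('n)" "\<alpha> \<in> A_set CARD('n) k"
    and "(\<Sum>i = 1..CARD('n). \<alpha> i) + k + (CARD('n) + 1) * j = m"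
  shows "dof_face \<nu> k F \<alpha> \<in> dofs T \<nu> m"
proof -
  define L where "L = m div (CARD('n) + 1)"
  have "j = (CARD('n) + 1) * j div (CARD('n) + 1)"
    by (rule nonzero_mult_div_cancel_left[symmetric]) simp
  also have "\<dots> \<le> L" unfolding L_def using assms(5) by (intro div_le_mono) simp
  finally have j: "L - (L - j) = j" by simp
  have "dof_face \<nu> k F \<alpha> \<in> dofs_level T \<nu> m (L - j)"
    unfolding dofs_level_def Let_def L_def[symmetric] j
    by (intro CollectI exI[of _ F] exI[of _ k] exI[of _ \<alpha>] conjI refl) (use assms in simp_all)
  then show ?thesis unfolding dofs_def L_def by auto
qed

text \<open>The converse of \<open>dofs_face_memI\<close>, with the mean as an extra case. From
  \<open>1 \<le> k\<close> and the upper bound on \<open>k\<close> all subtractions are exact, which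
  yields the additive equation.\<close>

lemma dofs_cases:
  fixes T :: "(real^'n) set"
  assumes "d \<in> dofs T \<nu> m"
  obtains (mean) "d = dof_mean T" "m mod (CARD('n) + 1) = 0"
  | (face) F k \<alpha> j where "d = dof_face \<nu> k F \<alpha>" "F \<in> sub_simplices T k" "1 \<le> k" "k \<le> CARD('n)"
      "\<alpha> \<in> A_set CARD('n) k" "(\<Sum>i = 1..CARD('n). \<alpha> i) + k + (CARD('n) + 1) * j = m"
proof (cases "d \<in> dofs_mean T m")
  case True
  then show ?thesis using mean by (auto simp: dofs_mean_def split: if_splits)
next
  case False
  then obtain l where "d \<in> dofs_level T \<nu> m l" using assms by (auto simp: dofs_def)
  then obtain F k \<alpha> where d: "d = dof_face \<nu> k F \<alpha>" "F \<in> sub_simplices T k" "1 \<le> k"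
    "\<alpha> \<in> A_set CARD('n) k"
    and k: "k \<le> min CARD('n) (m - (CARD('n) + 1) * (m div (CARD('n) + 1) - l))"
    and \<alpha>: "(\<Sum>i = 1..CARD('n). \<alpha> i) = m - k - (CARD('n) + 1) * (m div (CARD('n) + 1) - l)"
    unfolding dofs_level_def Let_def by blast
  define q where "q = (CARD('n) + 1) * (m div (CARD('n) + 1) - l)"
  from k \<alpha> \<open>1 \<le> k\<close> have "k \<le> CARD('n)" "(\<Sum>i = 1..CARD('n). \<alpha> i) + k + q = m"
    unfolding q_def[symmetric] by auto
  then show ?thesis using face d unfolding q_def by blast
qed

text \<open>The condition on \<open>card S\<close> ties the codimension to the order of the
  derivative, so deleting a vertex matches lowering the order by one; hence \<open>S\<close>,
  \<open>a\<close> and \<open>us\<close> all vary in the induction.\<close>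

lemma vertex_integral_derivative_eq_0:
  fixes C :: "(real^'n) set"
  assumes C: "\<not> affine_dependent C" "card C = CARD('n) + 1"
    and \<nu>: "normal_frames (convex hull C) \<nu>"
    and v: "real_polynomial_function v" and dofs: "\<forall>d\<in>dofs (convex hull C) \<nu> m. d v = 0"
    and "S \<subseteq> C" "a \<in> S" "length us \<le> m" "card S + (m - length us) mod (CARD('n) + 1) = CARD('n) + 1"
  shows "vertex_integral S a (foldr dir_deriv us v) = 0"
  using assms(6-)
proof (induction "length us" arbitrary: us S a rule: less_induct)
  case less
  define k where "k = (m - length us) mod (CARD('n) + 1)"
  define F where "F = convex hull S"
  define W where "W = (\<lambda>b. b - a) ` (S - {a}) \<union> \<nu> F ` {1..k}"
  have S: "\<not> affine_dependent S" using C(1) less.prems(1) affine_dependent_subset by blast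
  then have fin: "finite S" by (rule aff_independent_finite)
  have card: "card S + k = CARD('n) + 1" using less.prems(4) by (simp add: k_def)
  have k: "k \<le> CARD('n)" using mod_less_divisor[of "CARD('n) + 1"] unfolding k_def by (simp add: less_Suc_eq_le)
  have F: "F \<in> sub_simplices (convex hull C) k"
    using less.prems(1) card unfolding sub_simplices_convex_hull[OF C(1) k] F_def by blast
  have "span W = UNIV"
    unfolding W_def
  proof (cases "k = 0")
    \<comment> \<open>\<open>normal_frames\<close> speaks of positive codimension only; for
      \<open>k = 0\<close> there are no normals and the edges alone span.\<close>
    case True
    then show "span ((\<lambda>b. b - a) ` (S - {a}) \<union> \<nu> F ` {1..k}) = UNIV"
      by (intro span_edges_normals[OF S less.prems(2) card]) (auto simp: independent_empty)
  next
    case False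
    then have "k \<in> {1..CARD('n)}" using k by simp
    then have normals: "(\<forall>i\<in>{1..k}. norm (\<nu> F i) = 1 \<and> (\<forall>t\<in>tangent_space F. orthogonal (\<nu> F i) t)) \<and>
        inj_on (\<nu> F) {1..k} \<and> independent (\<nu> F ` {1..k})"
      using \<nu> F unfolding normal_frames_def by blast
    show "span ((\<lambda>b. b - a) ` (S - {a}) \<union> \<nu> F ` {1..k}) = UNIV"
      by (rule span_edges_normals[OF S less.prems(2) card]) (use normals in \<open>auto simp: F_def\<close>)
  qed
  then show ?case
  proof (rule vertex_integral_spanning_directions[OF fin v])
    fix ws :: "(real^'n) list"
    assume ws: "set ws \<subseteq> W" "length ws = length us"
    show "vertex_integral S a (foldr dir_deriv ws v) = 0"
    proof (cases "set ws \<subseteq> \<nu> F ` {1..k}")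
      case False
      then obtain u where u: "u \<in> set ws" "u \<notin> \<nu> F ` {1..k}" by blast
      with ws(1) have "u \<in> (\<lambda>b. b - a) ` (S - {a})" unfolding W_def by blast
      with u(1) obtain b where b: "b \<in> S" "b \<noteq> a" "b - a \<in> set ws" by blast
      define xs where "xs = remove1 (b - a) ws"
      \<comment> \<open>Two distinct vertices force \<open>k < CARD('n)\<close>, so the remainder
        grows to \<open>Suc k\<close> without wrapping around to 0.\<close>
      have "card {a, b} \<le> card S" using fin b less.prems(2) by (intro card_mono) auto
      then have "k < CARD('n)" using card b(2) by simp
      have len: "length us = Suc (length xs)"
        using b(3) ws(2) length_pos_if_in_set[OF b(3)] by (simp add: xs_def length_remove1)
      then have "m - length xs = Suc (m - length us)" using less.prems(3) by simp
      then have mod: "(m - length xs) mod (CARD('n) + 1) = Suc k"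
        using \<open>k < CARD('n)\<close> unfolding k_def by (simp add: mod_Suc)
      have "0 < card S" using fin less.prems(2) card_gt_0_iff by blast
      have zero: "vertex_integral (S - {x}) y (foldr dir_deriv xs v) = 0"
        if "x \<in> S" "y \<in> S" "x \<noteq> y" for x y
      proof (rule less.hyps)
        show "card (S - {x}) + (m - length xs) mod (CARD('n) + 1) = CARD('n) + 1"
          unfolding mod using that fin card \<open>0 < card S\<close> by simp
      qed (use that less.prems(1,3) len in auto)
      \<comment> \<open>The edge derivative is made the outermost one, so that it can be integrated
        out.\<close>
      have "mset ws = mset ((b - a) # xs)" using b(3) by (simp add: xs_def)
      then have "foldr dir_deriv ws v = foldr dir_deriv ((b - a) # xs) v"
        by (rule foldr_dir_deriv_cong_mset[OF v])
      then show ?thesis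
        using vertex_integral_edge_deriv_eq_0[OF fin less.prems(2) b(1) _
            real_polynomial_function_foldr_dir_deriv[OF v] zero[OF less.prems(2) b(1)] zero[OF b(1) less.prems(2)]]
          b(2) by simp
    next
      case True
      then have "ws \<in> map (\<nu> F) ` lists {1..k}" unfolding lists_image[symmetric] by auto
      then obtain js where js: "ws = map (\<nu> F) js" "set js \<subseteq> {1..k}" by auto
      show ?thesis
      proof (cases "k = 0")
        case True
        \<comment> \<open>Without normals the list is empty, so the order is 0. Then
          \<open>m\<close> itself is divisible by \<open>CARD('n) + 1\<close>, and the degree of
          freedom of level -1 is available.\<close>
        then have "ws = []" "us = []" using js ws by auto
        have "S = C"
          using card C True less.prems(1) by (intro card_subset_eq aff_independent_finite) auto
        have "dof_mean (convex hull C) \<in> dofs (convex hull C) \<nu> m"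
          using True \<open>us = []\<close> by (simp add: dofs_def dofs_mean_def k_def)
        then show ?thesis
          using dof_mean_eq_0_iff[OF C(1) _ C(2) v, of a] less.prems(2) \<open>S = C\<close> \<open>ws = []\<close> dofs by simp
      next
        case False
        define \<alpha> where "\<alpha> = count_list js"
        have \<alpha>0: "\<alpha> i = 0" if "i \<notin> {1..k}" for i
          using js(2) that by (auto simp: \<alpha>_def count_list_0_iff)
        have "set js \<subseteq> {1..CARD('n)}" using js(2) k by (meson atLeastatMost_subset_iff le_refl order_trans)
        then have "(\<Sum>i = 1..CARD('n). \<alpha> i) = length us"
          using sum_count_set[of js "{1..CARD('n)}"] js(1) ws(2) by (simp add: \<alpha>_def)
        \<comment> \<open>The remainder is the codimension \<open>k\<close>, and the quotient is the
          distance \<open>j\<close> of the level from the top level.\<close>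
        moreover have "(m - length us) div (CARD('n) + 1) * (CARD('n) + 1) + k = m - length us"
          unfolding k_def by (rule div_mult_mod_eq)
        ultimately have "dof_face \<nu> k F \<alpha> \<in> dofs (convex hull C) \<nu> m"
          using F False k \<alpha>0 less.prems(3)
          by (intro dofs_face_memI[where j = "(m - length us) div (CARD('n) + 1)"])
             (auto simp: A_set_def multi_indices_def algebra_simps)
        then have "dof_face \<nu> k F \<alpha> v = 0" using dofs by blast
        then show ?thesis
          unfolding F_def dof_face_eq_0_iff[OF S less.prems(2) v]
          using foldr_dir_deriv_frame[OF v js(2)] by (simp add: js(1) \<alpha>_def F_def)
      qed
    qed
  qed simp
qed

theorem lemma2p4:
  fixes T :: "(real^'n) set"
    and \<nu> :: "(real^'n) set \<Rightarrow> nat \<Rightarrow> real^'n"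
    and m :: nat
    and v :: "real^'n \<Rightarrow> real"
    and \<beta> :: "'n \<Rightarrow> nat"
  assumes "int CARD('n) simplex T"
    and "normal_frames T \<nu>"
    and "v \<in> polys m"
    and "\<forall>d\<in>dofs T \<nu> m. d v = 0"
    and "(\<Sum>i\<in>UNIV. \<beta> i) \<le> m"
  shows "\<forall>d\<in>dofs T \<nu> (m - (\<Sum>i\<in>UNIV. \<beta> i)). d (partial_deriv \<beta> v) = 0"
proof
  fix d assume d: "d \<in> dofs T \<nu> (m - (\<Sum>i\<in>UNIV. \<beta> i))"
  obtain C where C: "\<not> affine_dependent C" "card C = CARD('n) + 1" and T: "T = convex hull C"
    using assms(1) by (auto simp: simplex_def)
  have v: "real_polynomial_function v" using assms(3) by (rule polys_imp_real_polynomial_function)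
  obtain bs where bs: "length bs = (\<Sum>i\<in>UNIV. \<beta> i)" "partial_deriv \<beta> v = foldr dir_deriv bs v"
    using partial_deriv_foldr by metis
  have w: "real_polynomial_function (foldr dir_deriv bs v)"
    using v by (rule real_polynomial_function_foldr_dir_deriv)
  note vanish = vertex_integral_derivative_eq_0[OF C assms(2)[unfolded T] v assms(4)[unfolded T]]
  from d show "d (partial_deriv \<beta> v) = 0"
  proof (cases rule: dofs_cases)
    case mean
    obtain a where a: "a \<in> C" using C(2) by fastforce
    \<comment> \<open>All \<open>CARD('n) + 1\<close> vertices are used, so the required remainder
      is 0, which is when the mean belongs to the lower-order set.\<close>
    have "vertex_integral C a (foldr dir_deriv bs v) = 0"
      using mean(2) assms(5) bs(1) C(2) a by (intro vanish) auto
    then show ?thesis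
      using dof_mean_eq_0_iff[OF C(1) a C(2) w] by (simp add: mean(1) bs(2) T)
  next
    case (face F k \<alpha> j)
    obtain S where S: "S \<subseteq> C" "F = convex hull S" "card S + k = CARD('n) + 1"
      using face(2) unfolding T sub_simplices_convex_hull[OF C(1) face(4)] by blast
    have indep: "\<not> affine_dependent S" using C(1) S(1) affine_dependent_subset by blast
    obtain a where a: "a \<in> S" using S(3) face(4) by fastforce
    \<comment> \<open>The normal directions of the degree of freedom; put before \<open>bs\<close>,
      they turn its integrand into one iterated derivative of \<open>v\<close>.\<close>
    define as where "as = concat (map (\<lambda>i. replicate (\<alpha> i) (\<nu> F i)) [1..<Suc k])"
    have "length as = (\<Sum>i\<leftarrow>[1..<Suc k]. \<alpha> i)"
      by (simp add: as_def length_concat o_def)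
    also have "\<dots> = (\<Sum>i = 1..k. \<alpha> i)"
      by (subst sum_list_distinct_conv_sum_set) (auto intro: sum.cong)
    \<comment> \<open>Multi-indices in \<open>A_set\<close> vanish beyond \<open>k\<close>.\<close>
    also have "\<dots> = (\<Sum>i = 1..CARD('n). \<alpha> i)"
      using face(4,5) by (intro sum.mono_neutral_left) (auto simp: A_set_def)
    finally have len: "length (as @ bs) + k + (CARD('n) + 1) * j = m"
      using face(6) bs(1) assms(5) by simp
    then have "m - length (as @ bs) = k + (CARD('n) + 1) * j" by simp
    \<comment> \<open>As \<open>k \<le> CARD('n)\<close>, it is the remainder itself, so
      \<open>S\<close> has the codimension that \<open>vanish\<close> asks for.\<close>
    then have "(m - length (as @ bs)) mod (CARD('n) + 1) = k"
      using face(4) by (simp only: mod_mult_self2) simp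
    then have "vertex_integral S a (foldr dir_deriv (as @ bs) v) = 0"
      using len S a by (intro vanish) auto
    then show ?thesis
      unfolding face(1) S(2) bs(2) dof_face_eq_0_iff[OF indep a w]
      unfolding mixed_deriv_def foldr_dir_deriv_funpow by (simp add: as_def S(2))
  qed
qed

end
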